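(* Every Corson compact space is hereditarily a $D$-space; that is, if $X$ is Corson compact, then every subspace of $X$ is a $D$-space.
   Context: A space $X$ is Corson compact if $X$ is compact and can be embedded into a $\Sigma$-product of real lines, i.e. into $\{f\in\mathbb R^{I}: \{i\in I: f(i)\neq 0\}\text{ is countable}\}$ (with the subspace topology from the product $\mathbb R^I$) for some set $I$. A neighborhood assignment on a space $Y$ is a family $\{N(y):y\in Y\}$ of subsets of $Y$ with $y\in \operatorname{Int} N(y)$ for each $y\in Y$. A space $Y$ is a $D$-space if for every neighborhood assignment $\{N(y):y\in Y\}$ on $Y$ there is a closed discrete subset $D$ of $Y$ such that $Y=\bigcup\{N(y):y\in D\}$. *)

theory Defs
  imports "HOL-Analysis.Analysis"
begin

definition sigma_product :: "'i set \<Rightarrow> ('i \<Rightarrow> real) topology" where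
  "sigma_product I = subtopology (powertop_real I) {f. countable {i \<in> I. f i \<noteq> 0}}"

(* HOL cannot quantify existentially over types, so the type 'i from which the index set is
   taken is an explicit parameter. A theorem with hypothesis Corson_compact TYPE('i) X, 'i being
   a type variable, is universal in 'i and hence covers index sets of arbitrary size. *)
definition Corson_compact :: "'i itself \<Rightarrow> 'a topology \<Rightarrow> bool" where
  "Corson_compact (_ :: 'i itself) X \<longleftrightarrow>
     compact_space X \<and> (\<exists>(I :: 'i set) e. embedding_map X (sigma_product I) e)"

definition neighborhood_assignment :: "'a topology \<Rightarrow> ('a \<Rightarrow> 'a set) \<Rightarrow> bool" where
  "neighborhood_assignment Y N \<longleftrightarrow>
     (\<forall>y \<in> topspace Y. N y \<subseteq> topspace Y \<and> y \<in> Y interior_of N y)"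

definition closed_discrete_in :: "'a topology \<Rightarrow> 'a set \<Rightarrow> bool" where
  "closed_discrete_in Y D \<longleftrightarrow> closedin Y D \<and> subtopology Y D = discrete_topology D"

definition D_space :: "'a topology \<Rightarrow> bool" where
  "D_space Y \<longleftrightarrow>
     (\<forall>N. neighborhood_assignment Y N \<longrightarrow>
        (\<exists>D. closed_discrete_in Y D \<and> topspace Y = (\<Union>y \<in> D. N y)))"

definition hereditarily_D_space :: "'a topology \<Rightarrow> bool" where
  "hereditarily_D_space X \<longleftrightarrow> (\<forall>S \<subseteq> topspace X. D_space (subtopology X S))"

end

theory Submission
  imports Defs
begin

text \<open>
  Let \<open>X\<close> be a compact subspace of a \<open>\<Sigma>\<close>-product, \<open>S\<close> a subset and \<open>N\<close> a neighbourhood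
  assignment on \<open>S\<close>. Shrink each \<open>N y\<close> to a box given by a finite set \<open>G y\<close> of conditions of the
  form "coordinate \<open>i\<close> is within \<open>2r\<close> of the rational \<open>q\<close>", where \<open>y\<close> is even within \<open>r\<close>. A
  condition is of zero type (in \<open>J0\<close>) if \<open>q = 0\<close>, and of non-zero type (in \<open>J1\<close>) if it excludes
  the value \<open>0\<close>. Each point violates only countably many conditions of zero type and satisfies
  only countably many of non-zero type; these form its support.

  Compactness enters through a dichotomy (\<open>one_pattern\<close>). Fix a set \<open>b\<close> of conditions and consider
  the points \<open>y\<close> outside a set \<open>V\<close> whose \<open>G y\<close> consists of \<open>b\<close> and further conditions of zero type.
  Either some countable set of conditions meets the further part of every such \<open>G y\<close>, or finitely
  many of the boxes cover all these points. Indeed, if there is no such countable set, then for each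
  \<open>z\<close> in the closed set described by \<open>b\<close> the further part of some \<open>G y\<close> avoids the countably many
  zero conditions violated by \<open>z\<close>, so \<open>z\<close> is in the box of \<open>y\<close>; now use compactness.

  For a set \<open>M\<close> of conditions, the points supported in \<open>M\<close> form a closed set, which lies in the set
  of points \<open>y\<close> for which \<open>G y\<close> has only zero conditions outside \<open>M\<close>. A solution on \<open>M\<close>
  (\<open>solves\<close>) is a closed discrete set of points supported in \<open>M\<close> whose boxes cover that larger
  set. Covering the larger set is what makes unions of chains of solutions work
  (\<open>solves_chain\<close>): as \<open>G y\<close> is finite, \<open>y\<close> is already treated by one member of the chain, and the
  points added after that member avoid its boxes.

  A solution on a countable \<open>M\<close> containing given countably many conditions is built in \<open>\<omega>\<close> steps
  from the dichotomy (\<open>countable_solution\<close>). Infinite sets of conditions follow by induction on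
  cardinality (\<open>infinite_solution\<close>): enumerate the set in the order type of its cardinal and extend
  along proper initial segments, relative to what is covered already. A solution on the set of all
  conditions is the required closed discrete set.
\<close>

unbundle cardinal_syntax

section \<open>Closed discrete sets\<close>

lemma closed_discrete_in_iff:
  "closed_discrete_in T D \<longleftrightarrow> D \<subseteq> topspace T \<and> T derived_set_of D = {}"
  unfolding closed_discrete_in_def subtopology_eq_discrete_topology_eq closedin_contains_derived_set
  by auto

lemma closed_discrete_in_finite:
  assumes "t1_space T" "finite D" "D \<subseteq> topspace T"
  shows "closed_discrete_in T D"
  using assms by (simp add: closed_discrete_in_iff t1_space_derived_set_of_finite)

text \<open>Being closed and discrete means having no accumulation points, which is a local property.
  The local witness \<open>D'\<close> may be empty (near points off a closed set containing \<open>D\<close>), finite, or an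
  earlier stage of a construction of \<open>D\<close>.\<close>

lemma closed_discrete_in_locally:
  assumes "D \<subseteq> topspace T"
    and loc: "\<And>x. x \<in> topspace T \<Longrightarrow>
      \<exists>V D'. openin T V \<and> x \<in> V \<and> closed_discrete_in T D' \<and> V \<inter> D \<subseteq> D'"
  shows "closed_discrete_in T D"
proof -
  have "x \<notin> T derived_set_of D" for x
  proof
    assume x: "x \<in> T derived_set_of D"
    then have "x \<in> topspace T" by (simp add: in_derived_set_of)
    with loc obtain V D' where V: "openin T V" "x \<in> V" "closed_discrete_in T D'" "V \<inter> D \<subseteq> D'"
      by blast
    then have "x \<notin> T derived_set_of D'" by (simp add: closed_discrete_in_iff)
    then obtain W where "openin T W" "x \<in> W" "\<And>y. y \<in> D' \<Longrightarrow> y \<in> W \<Longrightarrow> y = x"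
      using \<open>x \<in> topspace T\<close> unfolding in_derived_set_of by metis
    then have "openin T (V \<inter> W)" "x \<in> V \<inter> W" using V by auto
    then obtain y where "y \<noteq> x" "y \<in> D" "y \<in> V \<inter> W"
      using x unfolding in_derived_set_of by metis
    with V(4) \<open>\<And>y. y \<in> D' \<Longrightarrow> y \<in> W \<Longrightarrow> y = x\<close> show False by blast
  qed
  with assms(1) show ?thesis by (auto simp: closed_discrete_in_iff)
qed

section \<open>Systems of conditions\<close>

text \<open>This isolates what is used of a compact subspace of a \<open>\<Sigma>\<close>-product. A condition \<open>j\<close> has a
  closed strong form \<open>K j\<close> and an open weak form \<open>Op j\<close>. A point sets up its box with conditions that
  it satisfies strongly, while membership in the box is tested weakly. The gap between the two
  allows compactness to be applied to a closed set containing all points with given conditions.\<close>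

locale condition_system =
  fixes X :: "'a topology" and K Op :: "'j \<Rightarrow> 'a set" and J0 J1 :: "'j set"
  assumes compact: "compact_space X"
    and t1: "t1_space X"
    and closed_K: "j \<in> J0 \<union> J1 \<Longrightarrow> closedin X (K j)"
    and open_Op: "j \<in> J0 \<union> J1 \<Longrightarrow> openin X (Op j)"
    and K_subset_Op: "j \<in> J0 \<union> J1 \<Longrightarrow> K j \<subseteq> Op j"
    and countable_J0: "x \<in> topspace X \<Longrightarrow> countable {j \<in> J0. x \<notin> K j}"
    and countable_J1: "x \<in> topspace X \<Longrightarrow> countable {j \<in> J1. x \<in> Op j}"
    and base: "openin X V \<Longrightarrow> y \<in> V \<Longrightarrow>
      \<exists>G. finite G \<and> G \<subseteq> J0 \<union> J1 \<and> (\<forall>j\<in>G. y \<in> K j) \<and> {x \<in> topspace X. \<forall>j\<in>G. x \<in> Op j} \<subseteq> V"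

text \<open>A neighbourhood assignment on \<open>S\<close>, refined to basic neighbourhoods.\<close>

locale condition_choice = condition_system X K Op J0 J1
  for X :: "'a topology" and K Op :: "'j \<Rightarrow> 'a set" and J0 J1 :: "'j set" +
  fixes S :: "'a set" and G :: "'a \<Rightarrow> 'j set"
  assumes S_subset: "S \<subseteq> topspace X"
    and finite_G: "y \<in> S \<Longrightarrow> finite (G y)"
    and G_subset: "y \<in> S \<Longrightarrow> G y \<subseteq> J0 \<union> J1"
    and G_K: "y \<in> S \<Longrightarrow> j \<in> G y \<Longrightarrow> y \<in> K j"
begin

abbreviation Y :: "'a topology" where "Y \<equiv> subtopology X S"

definition nbh :: "'a \<Rightarrow> 'a set" where "nbh y = {x \<in> S. \<forall>j\<in>G y. x \<in> Op j}"

abbreviation nbhs :: "'a set \<Rightarrow> 'a set" where "nbhs D \<equiv> \<Union>(nbh ` D)"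

text \<open>The conditions on which \<open>x\<close> differs from the zero function of the \<open>\<Sigma>\<close>-product. The strong
  form is used for \<open>J0\<close> and the weak form for \<open>J1\<close> in order that \<open>supported M\<close> is closed.\<close>

definition support :: "'a \<Rightarrow> 'j set" where
  "support x = {j \<in> J0. x \<notin> K j} \<union> {j \<in> J1. x \<in> Op j}"

definition supported :: "'j set \<Rightarrow> 'a set" where "supported M = {x \<in> S. support x \<subseteq> M}"

text \<open>The points whose box imposes outside \<open>M\<close> only conditions that the zero function satisfies.
  Since each \<open>G y\<close> is finite, this set commutes with unions of non-empty chains in \<open>M\<close>, whereas a point
  supported in the union of a chain need not be supported in any of its members.\<close>

definition trivial_off :: "'j set \<Rightarrow> 'a set" where "trivial_off M = {y \<in> S. G y - M \<subseteq> J0}"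

text \<open>\<open>V\<close> is the part of \<open>S\<close> that has been covered beforehand.\<close>

definition solves :: "'a set \<Rightarrow> 'j set \<Rightarrow> 'a set \<Rightarrow> bool" where
  "solves V M D \<longleftrightarrow>
     closed_discrete_in Y D \<and> D \<subseteq> supported M - V \<and> trivial_off M \<subseteq> V \<union> nbhs D"

text \<open>New points stay away from what the old ones cover; hence each box of an old point
  meets only the old set.\<close>

definition end_extends :: "'a set \<Rightarrow> 'a set \<Rightarrow> bool" where
  "end_extends D D' \<longleftrightarrow> D \<subseteq> D' \<and> (D' - D) \<inter> nbhs D = {}"

lemma end_extends_refl: "end_extends D D"
  by (simp add: end_extends_def)

lemma topspace_Y: "topspace Y = S"
  using S_subset by auto

lemma t1_Y: "t1_space Y"
  using t1 by (simp add: t1_space_subtopology)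

lemma openin_Op_Int:
  assumes "finite F" "F \<subseteq> J0 \<union> J1" shows "openin X {x \<in> topspace X. \<forall>j\<in>F. x \<in> Op j}"
proof -
  have "{x \<in> topspace X. \<forall>j\<in>F. x \<in> Op j} = (\<Inter>j\<in>F. Op j) \<inter> topspace X" by auto
  moreover have "openin X (Op j)" if "j \<in> F" for j using that assms(2) open_Op by blast
  ultimately show ?thesis using openin_INT[OF assms(1), of X Op] by simp
qed

lemma openin_nbh: assumes "y \<in> S" shows "openin Y (nbh y)"
proof -
  have "nbh y = {x \<in> topspace X. \<forall>j\<in>G y. x \<in> Op j} \<inter> S"
    using S_subset by (auto simp: nbh_def)
  then show ?thesis
    using openin_Op_Int[OF finite_G[OF assms] G_subset[OF assms]] by (auto simp: openin_subtopology)
qed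

lemma countable_support: "x \<in> S \<Longrightarrow> countable (support x)"
  using countable_J0 countable_J1 S_subset by (auto simp: support_def)

lemma closedin_supported: "closedin Y (supported M)"
proof -
  let ?C = "insert (topspace X) (K ` (J0 - M) \<union> (\<lambda>j. topspace X - Op j) ` (J1 - M))"
  have "closedin X (\<Inter>?C)"
    by (rule closedin_Inter) (use closed_K open_Op in \<open>auto intro!: closedin_diff\<close>)
  moreover have "supported M = \<Inter>?C \<inter> S"
    using S_subset by (auto simp: supported_def support_def)
  ultimately show ?thesis by (auto simp: closedin_subtopology)
qed

lemma supported_mono: "M \<subseteq> M' \<Longrightarrow> supported M \<subseteq> supported M'"
  by (auto simp: supported_def)

text \<open>A condition of non-zero type in \<open>G y\<close> is satisfied by \<open>y\<close>, so it belongs to the support.\<close>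

lemma supported_subset_trivial_off: "supported M \<subseteq> trivial_off M"
proof
  fix y assume y: "y \<in> supported M"
  then have "j \<in> J0" if "j \<in> G y - M" for j
    using that G_subset[of y] G_K[of y j] K_subset_Op[of j]
    unfolding supported_def support_def by blast
  with y show "y \<in> trivial_off M" by (auto simp: trivial_off_def supported_def)
qed

text \<open>Any accumulation point of \<open>D\<close> lies in the closed set \<open>supported M\<close>, hence in the open cover
  by \<open>V\<close> and the boxes of \<open>D\<close>. So it is enough that \<open>D\<close> is closed discrete inside each box.\<close>

lemma closed_discrete_if_covered:
  assumes V: "openin Y V" and D: "D \<subseteq> supported M - V"
    and cov: "trivial_off M \<subseteq> V \<union> nbhs D"
    and loc: "\<And>t. t \<in> D \<Longrightarrow> \<exists>D'. closed_discrete_in Y D' \<and> nbh t \<inter> D \<subseteq> D'"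
  shows "closed_discrete_in Y D"
proof (rule closed_discrete_in_locally)
  show "D \<subseteq> topspace Y" using D unfolding topspace_Y by (auto simp: supported_def)
  fix x assume "x \<in> topspace Y"
  then have xS: "x \<in> S" by (simp add: topspace_Y)
  have empty: "closed_discrete_in Y {}" by (simp add: closed_discrete_in_iff)
  consider "x \<notin> supported M" | "x \<in> V" | "x \<in> nbhs D"
    using supported_subset_trivial_off cov by blast
  then show "\<exists>W D'. openin Y W \<and> x \<in> W \<and> closed_discrete_in Y D' \<and> W \<inter> D \<subseteq> D'"
  proof cases
    case 1
    then show ?thesis
      using D empty xS closedin_supported[of M] unfolding closedin_def topspace_Y
      by (intro exI[of _ "S - supported M"] exI[of _ "{}"]) auto
  next
    case 2
    then show ?thesis using D empty V by (intro exI[of _ V] exI[of _ "{}"]) auto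
  next
    case 3
    then obtain t where t: "t \<in> D" "x \<in> nbh t" by blast
    then have "t \<in> S" using D by (auto simp: supported_def)
    then show ?thesis using t(2) openin_nbh loc[OF t(1)] by blast
  qed
qed

text \<open>The dichotomy behind the theorem, and the only place where compactness is used: a point with
  pattern \<open>b\<close> is covered by the finite set \<open>T\<close>, or one of its further conditions is in the
  countable set \<open>C\<close>. One of \<open>C\<close> and \<open>T\<close> can be taken empty.\<close>

lemma one_pattern:
  fixes b :: "'j set" and V :: "'a set"
  defines "W \<equiv> {y \<in> S - V. b \<subseteq> G y \<and> G y - b \<subseteq> J0}"
  shows "\<exists>C T. countable C \<and> finite T \<and> T \<subseteq> S - V \<and>
           (\<forall>y\<in>W. y \<in> nbhs T \<or> (G y - b) \<inter> C \<noteq> {})"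
proof (cases "\<exists>C. countable C \<and> (\<forall>y\<in>W. (G y - b) \<inter> C \<noteq> {})")
  case True
  then show ?thesis by (metis empty_subsetI finite.emptyI)
next
  case False
  let ?O = "\<lambda>y. {x \<in> topspace X. \<forall>j\<in>G y. x \<in> Op j}"
  \<comment> \<open>\<open>Q\<close> contains \<open>W\<close>, and it is closed because the conditions in \<open>b\<close> are taken in their strong form.\<close>
  define Q where "Q = \<Inter>(insert (topspace X) (K ` (b \<inter> (J0 \<union> J1))))"
  have "closedin X Q" unfolding Q_def by (rule closedin_Inter) (auto simp: closed_K)
  then have "compactin X Q" by (rule closedin_compact_space[OF compact])
  moreover have "Q \<subseteq> \<Union>(?O ` W)"
  proof
    fix z assume z: "z \<in> Q"
    then have zX: "z \<in> topspace X" by (simp add: Q_def)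
    \<comment> \<open>The failing first alternative is applied to the zero conditions violated by \<open>z\<close>.\<close>
    with False countable_J0 obtain y where y: "y \<in> W" "(G y - b) \<inter> {j \<in> J0. z \<notin> K j} = {}"
      by meson
    have "z \<in> Op j" if "j \<in> G y" for j
    proof -
      have "j \<in> b \<inter> (J0 \<union> J1) \<or> j \<in> J0 \<and> j \<in> G y - b"
        using that y(1) G_subset[of y] by (auto simp: W_def)
      then have "z \<in> K j" using z y(2) by (auto simp: Q_def)
      then show ?thesis using that y(1) G_subset[of y] K_subset_Op[of j] by (auto simp: W_def)
    qed
    with y zX show "z \<in> \<Union>(?O ` W)" by blast
  qed
  moreover have "openin X U" if "U \<in> ?O ` W" for U
    using that openin_Op_Int finite_G G_subset by (auto simp: W_def)
  ultimately obtain \<F> where F: "finite \<F>" "\<F> \<subseteq> ?O ` W" "Q \<subseteq> \<Union>\<F>"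
    using compactinD[of X Q "?O ` W"] by blast
  from finite_subset_image[OF F(1,2)] obtain T where "T \<subseteq> W" "finite T" "\<F> = ?O ` T"
    by blast
  with F(3) have T: "T \<subseteq> W" "finite T" "Q \<subseteq> \<Union>(?O ` T)" by simp_all
  have "y \<in> nbhs T" if "y \<in> W" for y
  proof -
    have "y \<in> Q" using that G_K S_subset by (auto simp: Q_def W_def)
    with T(3) obtain t where "t \<in> T" "\<forall>j\<in>G t. y \<in> Op j" by blast
    then show ?thesis using that by (auto simp: nbh_def W_def)
  qed
  with T show ?thesis by (intro exI[of _ "{}"] exI[of _ T]) (auto simp: W_def)
qed

text \<open>All patterns within a finite set are handled with the same \<open>V\<close>, so that the set \<open>T\<close> of new
  points is still finite and still avoids \<open>V\<close>.\<close>

lemma finitely_many_patterns: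
  assumes "finite A"
  shows "\<exists>C T. countable C \<and> finite T \<and> T \<subseteq> S - V \<and>
    (\<forall>y\<in>S - V. \<forall>b\<subseteq>A. b \<subseteq> G y \<and> G y - b \<subseteq> J0 \<longrightarrow> y \<in> nbhs T \<or> (G y - b) \<inter> C \<noteq> {})"
proof -
  define R where "R b C T \<longleftrightarrow> countable C \<and> finite T \<and> T \<subseteq> S - V \<and>
      (\<forall>y\<in>{y \<in> S - V. b \<subseteq> G y \<and> G y - b \<subseteq> J0}. y \<in> nbhs T \<or> (G y - b) \<inter> C \<noteq> {})"
    for b C T
  have "\<exists>C T. R b C T" for b unfolding R_def by (rule one_pattern)
  then obtain C T where "\<And>b. R b (C b) (T b)" by metis
  note CT = this[unfolded R_def]
  have "countable (\<Union>b\<in>Pow A. C b)" "finite (\<Union>b\<in>Pow A. T b)" "(\<Union>b\<in>Pow A. T b) \<subseteq> S - V"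
    using CT assms by (auto intro!: countable_UN simp: countable_finite)
  moreover have "y \<in> nbhs (\<Union>b\<in>Pow A. T b) \<or> (G y - b) \<inter> (\<Union>b\<in>Pow A. C b) \<noteq> {}"
    if "y \<in> S - V" "b \<subseteq> A" "b \<subseteq> G y" "G y - b \<subseteq> J0" for y b
    using CT[of b] that by blast
  ultimately show ?thesis
    by (intro exI[of _ "\<Union>b\<in>Pow A. C b"] exI[of _ "\<Union>b\<in>Pow A. T b"] conjI ballI allI impI) simp_all
qed

section \<open>The countable case\<close>

text \<open>Step \<open>k\<close> adds a countable set of conditions and a finite set of points outside the part
  \<open>U f k\<close> covered so far. It treats all patterns within a finite set \<open>A f k\<close>, and these finite sets
  exhaust \<open>M\<close>. A point that is trivial off \<open>M\<close> has its pattern \<open>G y \<inter> M\<close> treated at some step; its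
  further conditions lie outside \<open>M\<close>, thus avoid the countable set added there, and so the point gets
  covered. Each box of a point added at step \<open>k\<close> meets only the finitely many points added up to
  step \<open>k\<close>.\<close>

lemma countable_solution:
  assumes V: "openin Y V" and E: "countable E"
  shows "\<exists>M D. E \<subseteq> M \<and> countable M \<and> solves V M D"
proof -
  define A where "A f k = (\<Union>i<k. {m \<in> fst (f i). to_nat_on (fst (f i)) m < k})"
    for f :: "nat \<Rightarrow> 'j set \<times> 'a set" and k
  define U where "U f k = V \<union> nbhs (\<Union>i<k. snd (f i))"
    for f :: "nat \<Rightarrow> 'j set \<times> 'a set" and k
  define P where "P f k r \<longleftrightarrow> (let C = fst r; T = snd r in
      countable C \<and> E \<subseteq> C \<and> finite T \<and> T \<subseteq> S - U f k \<and> (\<forall>t\<in>T. support t \<subseteq> C) \<and>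
      (\<forall>y\<in>S - U f k. \<forall>b\<subseteq>A f k. b \<subseteq> G y \<and> G y - b \<subseteq> J0 \<longrightarrow>
         y \<in> nbhs T \<or> (G y - b) \<inter> C \<noteq> {}))"
    for f :: "nat \<Rightarrow> 'j set \<times> 'a set" and k r
  have "\<exists>f. \<forall>k. P f k (f k)"
  proof (rule dependent_wf_choice[where P = P, OF wf_less])
    fix f g :: "nat \<Rightarrow> 'j set \<times> 'a set" and k r
    assume "\<And>i. (i, k) \<in> {(x, y). x < y} \<Longrightarrow> f i = g i"
    then have "A f k = A g k" "U f k = U g k" by (auto simp: A_def U_def)
    then show "P f k r = P g k r" by (simp add: P_def)
  next
    fix k and f :: "nat \<Rightarrow> 'j set \<times> 'a set"
    assume prev: "\<And>i. (i, k) \<in> {(x, y). x < y} \<Longrightarrow> P f i (f i)"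
    have "finite {m \<in> fst (f i). to_nat_on (fst (f i)) m < k}" if "i < k" for i
    proof -
      have "countable (fst (f i))" using prev[of i] that by (auto simp: P_def Let_def)
      then have "inj_on (to_nat_on (fst (f i))) (fst (f i))" by (rule inj_on_to_nat_on)
      then have "finite (to_nat_on (fst (f i)) -` {..<k} \<inter> fst (f i))"
        by (intro finite_vimage_IntI) auto
      moreover have "{m \<in> fst (f i). to_nat_on (fst (f i)) m < k}
          = to_nat_on (fst (f i)) -` {..<k} \<inter> fst (f i)" by auto
      ultimately show ?thesis by simp
    qed
    then have "finite (A f k)" by (auto simp: A_def)
    from finitely_many_patterns[OF this, of "U f k"] obtain C T where CT: "countable C" "finite T"
      "T \<subseteq> S - U f k"
      "\<forall>y\<in>S - U f k. \<forall>b\<subseteq>A f k. b \<subseteq> G y \<and> G y - b \<subseteq> J0 \<longrightarrow>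
         y \<in> nbhs T \<or> (G y - b) \<inter> C \<noteq> {}" by blast
    have "countable (\<Union>t\<in>T. support t)"
      using CT by (intro countable_UN countable_support) (auto simp: countable_finite)
    \<comment> \<open>Adding the supports of the new points keeps them supported in \<open>M\<close>.\<close>
    moreover define C' where "C' = C \<union> E \<union> (\<Union>t\<in>T. support t)"
    ultimately have "countable C'" "C \<subseteq> C'" "E \<subseteq> C'" "\<forall>t\<in>T. support t \<subseteq> C'"
      using CT(1) E by auto
    moreover have "y \<in> nbhs T \<or> (G y - b) \<inter> C' \<noteq> {}"
      if "y \<in> S - U f k" "b \<subseteq> A f k" "b \<subseteq> G y" "G y - b \<subseteq> J0" for y b
    proof -
      have "y \<in> nbhs T \<or> (G y - b) \<inter> C \<noteq> {}" using CT(4) that by simp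
      then show ?thesis using \<open>C \<subseteq> C'\<close> by blast
    qed
    ultimately have "P f k (C', T)"
      using CT(2,3) unfolding P_def Let_def fst_conv snd_conv by (intro conjI ballI allI impI) simp_all
    then show "\<exists>r. P f k r" ..
  qed
  then obtain f where "\<forall>k. P f k (f k)" ..
  then have count: "countable (fst (f k))" and EC: "E \<subseteq> fst (f k)" and fin: "finite (snd (f k))"
    and new: "snd (f k) \<subseteq> S - U f k" and supp: "\<And>t. t \<in> snd (f k) \<Longrightarrow> support t \<subseteq> fst (f k)"
    and task: "\<And>y b. y \<in> S - U f k \<Longrightarrow> b \<subseteq> A f k \<Longrightarrow> b \<subseteq> G y \<Longrightarrow> G y - b \<subseteq> J0 \<Longrightarrow>
         y \<in> nbhs (snd (f k)) \<or> (G y - b) \<inter> fst (f k) \<noteq> {}" for k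
    unfolding P_def Let_def by simp_all
  define M where "M = (\<Union>k. fst (f k))"
  define D where "D = (\<Union>k. snd (f k))"
  have DM: "D \<subseteq> supported M - V"
    using new supp by (fastforce simp: D_def M_def supported_def U_def)
  have triv: "trivial_off M \<subseteq> V \<union> nbhs D"
  proof
    fix y assume y: "y \<in> trivial_off M"
    then have yS: "y \<in> S" by (simp add: trivial_off_def)
    have "\<exists>k. b \<subseteq> A f k" if "finite b" "b \<subseteq> M" for b
      using that
    proof (induction b)
      case empty then show ?case by simp
    next
      case (insert m b)
      then obtain k i where k: "b \<subseteq> A f k" "m \<in> fst (f i)" by (auto simp: M_def)
      define l where "l = Suc (k + i + to_nat_on (fst (f i)) m)"
      have "A f k \<subseteq> A f l" by (fastforce simp: A_def l_def)
      moreover have "m \<in> A f l" using k(2) by (auto simp: A_def l_def intro!: bexI[of _ i])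
      ultimately show ?case using k by blast
    qed
    then obtain k where k: "G y \<inter> M \<subseteq> A f k" using finite_G[OF yS] by blast
    \<comment> \<open>The pattern of \<open>y\<close> is treated at step \<open>k\<close>, and its further conditions are not in \<open>M\<close>.\<close>
    have "G y - G y \<inter> M \<subseteq> J0" using y by (auto simp: trivial_off_def)
    moreover have "(G y - G y \<inter> M) \<inter> fst (f k) = {}" by (auto simp: M_def)
    ultimately have "y \<in> U f k \<or> y \<in> nbhs (snd (f k))" using task[of y k "G y \<inter> M"] k yS by blast
    then show "y \<in> V \<union> nbhs D" by (auto simp: U_def D_def)
  qed
  have "closed_discrete_in Y D"
  proof (rule closed_discrete_if_covered[OF V DM triv])
    fix t assume "t \<in> D"
    then obtain k where t: "t \<in> snd (f k)" by (auto simp: D_def)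
    have "nbh t \<inter> D \<subseteq> (\<Union>i\<le>k. snd (f i))"
    proof
      fix d assume d: "d \<in> nbh t \<inter> D"
      then obtain i where i: "d \<in> snd (f i)" by (auto simp: D_def)
      have "\<not> k < i" using d t i new[of i] by (auto simp: U_def)
      then show "d \<in> (\<Union>i\<le>k. snd (f i))" using i by auto
    qed
    moreover have "closed_discrete_in Y (\<Union>i\<le>k. snd (f i))"
      using new fin by (intro closed_discrete_in_finite t1_Y) (auto simp: topspace_Y simp del: topspace_subtopology)
    ultimately show "\<exists>D'. closed_discrete_in Y D' \<and> nbh t \<inter> D \<subseteq> D'" by blast
  qed
  with DM triv have "solves V M D" by (simp add: solves_def)
  moreover have "countable M" "E \<subseteq> M" using count EC by (auto simp: M_def)
  ultimately show ?thesis by blast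
qed

section \<open>Chains of solutions\<close>

text \<open>The finite set \<open>G y \<inter> (\<Union>e\<in>A. M e)\<close> is contained
  in a single \<open>M e\<close>, so a point \<open>y\<close> that is trivial off the union is trivial off \<open>M e\<close>. The first two claims include the empty
  chain, which occurs at the least element of a well-ordered construction.\<close>

lemma solves_chain:
  assumes V: "openin Y V"
    and sol: "\<And>e. e \<in> A \<Longrightarrow> solves V (M e) (D e)"
    and chain: "\<And>e e'. e \<in> A \<Longrightarrow> e' \<in> A \<Longrightarrow>
      M e \<subseteq> M e' \<and> end_extends (D e) (D e') \<or> M e' \<subseteq> M e \<and> end_extends (D e') (D e)"
  shows "closed_discrete_in Y (\<Union>e\<in>A. D e)" "(\<Union>e\<in>A. D e) \<subseteq> supported (\<Union>e\<in>A. M e) - V"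
    "A \<noteq> {} \<Longrightarrow> solves V (\<Union>e\<in>A. M e) (\<Union>e\<in>A. D e)"
proof -
  let ?M = "\<Union>e\<in>A. M e" and ?D = "\<Union>e\<in>A. D e"
  show DM: "?D \<subseteq> supported ?M - V"
  proof (rule UN_least)
    fix e assume "e \<in> A"
    then have "M e \<subseteq> ?M" by (rule UN_upper)
    then have "supported (M e) \<subseteq> supported ?M" by (rule supported_mono)
    moreover have "D e \<subseteq> supported (M e) - V"
      using sol[OF \<open>e \<in> A\<close>] by (simp only: solves_def)
    ultimately show "D e \<subseteq> supported ?M - V" by blast
  qed
  have triv: "trivial_off ?M \<subseteq> V \<union> nbhs ?D" if "A \<noteq> {}"
  proof
    fix y assume y: "y \<in> trivial_off ?M"
    then have yS: "y \<in> S" by (simp add: trivial_off_def)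
    have "\<exists>e\<in>A. b \<subseteq> M e" if "finite b" "b \<subseteq> ?M" for b
      using that
    proof (induction b)
      case empty then show ?case using \<open>A \<noteq> {}\<close> by auto
    next
      case (insert m b)
      then obtain e e' where e: "e \<in> A" "b \<subseteq> M e" "e' \<in> A" "m \<in> M e'" by auto
      from chain[OF e(1,3)] e(2,4) have "insert m b \<subseteq> M e' \<or> insert m b \<subseteq> M e" by blast
      then show ?case using e(1,3) by blast
    qed
    then obtain e where e: "e \<in> A" "G y \<inter> ?M \<subseteq> M e" using finite_G[OF yS] by blast
    then have "y \<in> trivial_off (M e)" using y by (auto simp: trivial_off_def)
    then show "y \<in> V \<union> nbhs ?D" using sol[OF e(1)] e(1) by (auto simp: solves_def)
  qed
  show cd: "closed_discrete_in Y ?D"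
  proof (cases "A = {}")
    case True
    then show ?thesis by (simp add: closed_discrete_in_iff)
  next
    case False
    show ?thesis
    proof (rule closed_discrete_if_covered[OF V DM triv[OF False]])
      fix t assume "t \<in> ?D"
      then obtain e where e: "e \<in> A" "t \<in> D e" by blast
      then have "nbh t \<inter> ?D \<subseteq> D e"
        using chain[OF e(1)] unfolding end_extends_def by blast
      then show "\<exists>D'. closed_discrete_in Y D' \<and> nbh t \<inter> ?D \<subseteq> D'"
        using sol[OF e(1)] unfolding solves_def by blast
    qed
  qed
  show "solves V ?M ?D" if "A \<noteq> {}"
    using cd DM triv[OF that] by (simp add: solves_def)
qed

lemma openin_nbhs: "D \<subseteq> S \<Longrightarrow> openin Y (nbhs D)"
  using openin_nbh by blast

text \<open>The extension step: what \<open>D0\<close> covers is treated as already covered when looking for \<open>D\<close>.\<close>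

lemma solves_union:
  assumes "closed_discrete_in Y D0" "D0 \<subseteq> supported M - V" "solves (V \<union> nbhs D0) M D"
  shows "solves V M (D0 \<union> D)"
proof -
  have "Y derived_set_of (D0 \<union> D) = {}" "D0 \<union> D \<subseteq> topspace Y"
    using assms unfolding solves_def closed_discrete_in_iff derived_set_of_Un by auto
  then show ?thesis
    using assms unfolding solves_def closed_discrete_in_iff by blast
qed

section \<open>Induction on cardinality\<close>

lemma countable_ordLeq_infinite:
  assumes "countable A" "infinite B" shows "|A| \<le>o |B|"
proof -
  have "|A| \<le>o |UNIV :: nat set|"
    using assms(1) unfolding countable_def card_of_ordLeq[symmetric] by auto
  then show ?thesis using assms(2) infinite_iff_card_of_nat ordLeq_transitive by blast
qed

text \<open>For uncountable \<open>E\<close>, well-ordered by its cardinal, stage \<open>e\<close> takes the union of the earlier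
  solutions and extends it to the earlier conditions together with \<open>e\<close>, by the induction hypothesis
  relative to what is covered. This applies because the bound on the size of the sets \<open>M\<close> keeps
  every stage below the cardinality of \<open>E\<close>.\<close>

lemma infinite_solution:
  assumes "openin Y V" "infinite E"
  shows "\<exists>M D. E \<subseteq> M \<and> |M| \<le>o |E| \<and> solves V M D"
  using assms
proof (induction "|E|" arbitrary: E V rule: wf_induct_rule[OF wf_ordLess])
  case 1
  note V = \<open>openin Y V\<close> and E = \<open>infinite E\<close>
  have IH: "\<exists>M D. E' \<subseteq> M \<and> |M| \<le>o |E'| \<and> solves V' M D"
    if "|E'| <o |E|" "openin Y V'" "infinite E'" for E' V'
    using 1 that by blast
  show ?case
  proof (cases "countable E")
    case True
    then show ?thesis using countable_solution[OF V True] countable_ordLeq_infinite[OF _ E] by blast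
  next
    case False
    \<comment> \<open>Adjoining the same countably infinite set at all stages keeps the sets in question infinite,
      so that the cardinal arithmetic is uniform over finite and infinite initial segments.\<close>
    obtain Q where Q: "Q \<subseteq> E" "infinite Q" "countable Q"
      using E by (meson infinite_countable_subset')
    have Q_less: "|Q| <o |E|"
    proof -
      have "\<not> |E| \<le>o |Q|"
        using False Q(3) by (metis card_of_ordLeq countable_image_inj_on countable_subset image_subset_iff subsetI)
      then show ?thesis
        using not_ordLeq_iff_ordLess[OF card_of_Well_order card_of_Well_order] by blast
    qed
    let ?r = "|E|"
    have wo: "well_order_on E ?r" using card_of_Well_order[of E] by (simp only: Field_card_of)
    define R where "R = ?r - Id"
    have "wf R" using wo by (simp add: R_def well_order_on_def)
    have R_iff: "(e', e) \<in> R \<longleftrightarrow> e' \<in> underS ?r e" for e e' by (auto simp: R_def underS_def)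
    define M0 where "M0 f e = (\<Union>e'\<in>underS ?r e. fst (f e'))" for f :: "'j \<Rightarrow> 'j set \<times> 'a set" and e
    define D0 where "D0 f e = (\<Union>e'\<in>underS ?r e. snd (f e'))" for f :: "'j \<Rightarrow> 'j set \<times> 'a set" and e
    define P where "P f e s \<longleftrightarrow> (e \<in> E \<longrightarrow> e \<in> fst s \<and> |fst s| \<le>o |Q \<union> underS ?r e| \<and>
        solves V (fst s) (snd s) \<and>
        (\<forall>e'\<in>underS ?r e. fst (f e') \<subseteq> fst s \<and> end_extends (snd (f e')) (snd s)))"
      for f :: "'j \<Rightarrow> 'j set \<times> 'a set" and e s
    have underS_E: "underS ?r e \<subseteq> E" for e
      using Order_Relation.underS_Field[of ?r e] by (simp only: Field_card_of)
    have tot: "e = e' \<or> e \<in> underS ?r e' \<or> e' \<in> underS ?r e" if "e \<in> E" "e' \<in> E" for e e'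
      using wo that unfolding well_order_on_def linear_order_on_def total_on_def underS_def
      by auto
    have small: "|Q \<union> underS ?r e| <o |E|" if "e \<in> E" for e
    proof (rule card_of_Un_ordLess_infinite[OF E Q_less])
      show "|underS ?r e| <o ?r"
        using card_of_underS[OF card_of_Card_order, of e E] that by (simp only: Field_card_of)
    qed
    have mono: "underS ?r e' \<subseteq> underS ?r e" if "e' \<in> underS ?r e" for e e'
      using wo that underS_incr[of ?r] unfolding well_order_on_def linear_order_on_def
        partial_order_on_def preorder_on_def underS_def trans_def antisym_def by blast
    have "\<exists>f. \<forall>e. P f e (f e)"
    proof (rule dependent_wf_choice[where P = P, OF \<open>wf R\<close>])
      fix f g :: "'j \<Rightarrow> 'j set \<times> 'a set" and e s
      assume "\<And>e'. (e', e) \<in> R \<Longrightarrow> f e' = g e'"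
      then show "P f e s = P g e s" by (simp add: P_def R_iff)
    next
      fix e and f :: "'j \<Rightarrow> 'j set \<times> 'a set"
      assume "\<And>e'. (e', e) \<in> R \<Longrightarrow> P f e' (f e')"
      then have prev: "|fst (f e')| \<le>o |Q \<union> underS ?r e'|" "solves V (fst (f e')) (snd (f e'))"
        "\<And>e''. e'' \<in> underS ?r e' \<Longrightarrow> fst (f e'') \<subseteq> fst (f e') \<and> end_extends (snd (f e'')) (snd (f e'))"
        if "e' \<in> underS ?r e" for e'
        using that underS_E[of e] by (auto simp: P_def R_iff)
      show "\<exists>s. P f e s"
      proof (cases "e \<in> E")
        case False then show ?thesis by (simp add: P_def)
      next
        case True
        have chain: "fst (f d) \<subseteq> fst (f d') \<and> end_extends (snd (f d)) (snd (f d')) \<or>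
            fst (f d') \<subseteq> fst (f d) \<and> end_extends (snd (f d')) (snd (f d))"
          if dd: "d \<in> underS ?r e" "d' \<in> underS ?r e" for d d'
        proof -
          have "d \<in> E" "d' \<in> E" using dd underS_E[of e] by auto
          from tot[OF this] show ?thesis
            by (elim disjE) (use prev(3) dd in \<open>simp_all add: end_extends_refl\<close>)
        qed
        note un = solves_chain[where A = "underS ?r e" and M = "\<lambda>e. fst (f e)"
            and D = "\<lambda>e. snd (f e)", OF V prev(2) chain, folded M0_def D0_def]
        let ?Q = "Q \<union> underS ?r e"
        have inf: "infinite ?Q" using Q by simp
        have "|M0 f e| \<le>o |?Q|" unfolding M0_def
        proof (rule card_of_UNION_ordLeq_infinite[OF inf])
          show "|underS ?r e| \<le>o |?Q|" by (simp add: card_of_mono1)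
          show "\<forall>e'\<in>underS ?r e. |fst (f e')| \<le>o |?Q|"
          proof
            fix e' assume e': "e' \<in> underS ?r e"
            have "|Q \<union> underS ?r e'| \<le>o |?Q|" using mono[OF e'] by (intro card_of_mono1) auto
            then show "|fst (f e')| \<le>o |?Q|" using prev(1)[OF e'] ordLeq_transitive by blast
          qed
        qed
        moreover have "|insert e Q| \<le>o |?Q|"
          using Q inf by (intro countable_ordLeq_infinite) auto
        ultimately have le: "|M0 f e \<union> insert e Q| \<le>o |?Q|"
          by (intro card_of_Un_ordLeq_infinite_Field card_of_Card_order)
            (simp_all only: Field_card_of inf not_False_eq_True)
        then have "|M0 f e \<union> insert e Q| <o |E|" using small[OF True] ordLeq_ordLess_trans by blast
        moreover have "openin Y (V \<union> nbhs (D0 f e))"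
          using V un(2) by (intro openin_Un openin_nbhs) (auto simp: supported_def)
        moreover have "infinite (M0 f e \<union> insert e Q)" using Q by simp
        ultimately obtain M D where MD: "M0 f e \<union> insert e Q \<subseteq> M" "|M| \<le>o |M0 f e \<union> insert e Q|"
          "solves (V \<union> nbhs (D0 f e)) M D"
          using IH by meson
        have "solves V M (D0 f e \<union> D)"
          using un(1,2) MD(1,3) supported_mono[of "M0 f e" M] by (intro solves_union) auto
        moreover have "end_extends (snd (f e')) (D0 f e \<union> D)" if "e' \<in> underS ?r e" for e'
        proof -
          have "(D0 f e - snd (f e')) \<inter> nbhs (snd (f e')) = {}"
            using chain[OF that] unfolding D0_def end_extends_def by blast
          moreover have "D \<inter> nbhs (snd (f e')) = {}"
            using MD(3) that unfolding D0_def solves_def by blast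
          moreover have "snd (f e') \<subseteq> D0 f e" using that by (auto simp: D0_def)
          ultimately show ?thesis unfolding end_extends_def by blast
        qed
        moreover have "|M| \<le>o |?Q|" using MD(2) le ordLeq_transitive by blast
        moreover have "fst (f e') \<subseteq> M" if "e' \<in> underS ?r e" for e'
          using that MD(1) by (auto simp: M0_def)
        ultimately have "P f e (M, D0 f e \<union> D)"
          using MD(1) by (simp add: P_def)
        then show ?thesis ..
      qed
    qed
    then obtain f where f: "\<And>e. P f e (f e)" by blast
    have sol: "solves V (fst (f e)) (snd (f e))" if "e \<in> E" for e using f[of e] that by (simp add: P_def)
    have chain: "fst (f d) \<subseteq> fst (f d') \<and> end_extends (snd (f d)) (snd (f d')) \<or>
        fst (f d') \<subseteq> fst (f d) \<and> end_extends (snd (f d')) (snd (f d))"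
      if "d \<in> E" "d' \<in> E" for d d'
      using tot[OF that]
    proof (elim disjE)
      assume "d = d'"
      then show ?thesis by (simp add: end_extends_refl)
    next
      assume "d \<in> underS ?r d'"
      then show ?thesis using f[of d'] that by (simp add: P_def)
    next
      assume "d' \<in> underS ?r d"
      then show ?thesis using f[of d] that by (simp add: P_def)
    qed
    have "solves V (\<Union>e\<in>E. fst (f e)) (\<Union>e\<in>E. snd (f e))"
      using solves_chain(3)[where A = E and M = "\<lambda>e. fst (f e)"
          and D = "\<lambda>e. snd (f e)", OF V sol chain] E by auto
    moreover have "E \<subseteq> (\<Union>e\<in>E. fst (f e))" using f by (auto simp: P_def)
    moreover have "|\<Union>e\<in>E. fst (f e)| \<le>o |E|"
    proof (rule card_of_UNION_ordLeq_infinite[OF E])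
      show "\<forall>e\<in>E. |fst (f e)| \<le>o |E|"
        using f small unfolding P_def by (meson ordLeq_ordLess_trans ordLess_imp_ordLeq)
    qed (rule card_of_mono1[OF order_refl])
    ultimately show ?thesis by blast
  qed
qed

text \<open>Every point is trivial off the set of all conditions.\<close>

lemma closed_discrete_kernel: "\<exists>D. closed_discrete_in Y D \<and> S \<subseteq> nbhs D"
proof -
  have "\<exists>M D. (UNIV :: 'j set) \<subseteq> M \<and> solves {} M D"
  proof (cases "finite (UNIV :: 'j set)")
    case True
    then show ?thesis
      using countable_solution[OF openin_empty countable_finite, of UNIV] by auto
  next
    case False
    then show ?thesis using infinite_solution[OF openin_empty, of UNIV] by auto
  qed
  then obtain D where "solves {} UNIV D" by (metis top.extremum_unique)
  then show ?thesis by (auto simp: solves_def trivial_off_def)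
qed

end

lemma (in condition_system) hereditarily_D: "hereditarily_D_space X"
  unfolding hereditarily_D_space_def D_space_def
proof (intro allI impI)
  fix S N assume S: "S \<subseteq> topspace X" and N: "neighborhood_assignment (subtopology X S) N"
  have topS: "topspace (subtopology X S) = S" using S by auto
  have "\<exists>G. finite G \<and> G \<subseteq> J0 \<union> J1 \<and> (\<forall>j\<in>G. y \<in> K j) \<and> {x \<in> S. \<forall>j\<in>G. x \<in> Op j} \<subseteq> N y"
    if "y \<in> S" for y
  proof -
    from N that obtain W where "openin (subtopology X S) W" "y \<in> W" "W \<subseteq> N y"
      unfolding neighborhood_assignment_def topS interior_of_def by blast
    then obtain O' where O': "openin X O'" "y \<in> O'" "O' \<inter> S \<subseteq> N y"
      unfolding openin_subtopology by auto
    from base[OF O'(1,2)] obtain G where G: "finite G" "G \<subseteq> J0 \<union> J1" "\<forall>j\<in>G. y \<in> K j"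
      "{x \<in> topspace X. \<forall>j\<in>G. x \<in> Op j} \<subseteq> O'"
      by (elim exE conjE)
    have "{x \<in> S. \<forall>j\<in>G. x \<in> Op j} \<subseteq> {x \<in> topspace X. \<forall>j\<in>G. x \<in> Op j} \<inter> S"
      using S by auto
    also have "\<dots> \<subseteq> N y" using G(4) O'(3) by auto
    finally show ?thesis using G(1-3) by (intro exI[of _ G] conjI)
  qed
  then have "\<forall>y\<in>S. \<exists>G. finite G \<and> G \<subseteq> J0 \<union> J1 \<and> (\<forall>j\<in>G. y \<in> K j) \<and>
      {x \<in> S. \<forall>j\<in>G. x \<in> Op j} \<subseteq> N y" by (rule ballI)
  from bchoice[OF this] obtain G where "\<forall>y\<in>S. finite (G y) \<and> G y \<subseteq> J0 \<union> J1 \<and>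
      (\<forall>j\<in>G y. y \<in> K j) \<and> {x \<in> S. \<forall>j\<in>G y. x \<in> Op j} \<subseteq> N y" ..
  note G = bspec[OF this]
  interpret condition_choice X K Op J0 J1 S G
    using S G by unfold_locales auto
  obtain D where D: "closed_discrete_in Y D" "S \<subseteq> nbhs D" using closed_discrete_kernel by blast
  have "D \<subseteq> S" using D(1) unfolding closed_discrete_in_iff topS by simp
  then have "nbh y \<subseteq> N y \<and> N y \<subseteq> S" if "y \<in> D" for y
    using that G[of y] N unfolding nbh_def neighborhood_assignment_def topS by blast
  with D(2) have "topspace Y = (\<Union>y\<in>D. N y)"
    unfolding topS by blast
  with D(1) show "\<exists>D. closed_discrete_in Y D \<and> topspace Y = (\<Union>y\<in>D. N y)" by blast
qed

section \<open>Corson compact spaces\<close>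

text \<open>A radius below a third of \<open>\<bar>t\<bar>\<close> makes every \<open>q\<close> within \<open>r\<close> of \<open>t\<close> have absolute value at least
  \<open>2 * r\<close>, so that the weak condition excludes \<open>0\<close>. A radius below a third of \<open>\<epsilon>\<close> keeps the weak
  condition inside \<open>U\<close>, because points satisfying it are within \<open>3 * r\<close> of \<open>t\<close>.\<close>

lemma rational_condition:
  fixes t :: real and U :: "real set"
  assumes "open U" "t \<in> U"
  shows "\<exists>q r :: rat. 0 < r \<and> (q = 0 \<or> 2 * r \<le> \<bar>q\<bar>) \<and> \<bar>t - of_rat q\<bar> \<le> of_rat r \<and>
           (\<forall>s. \<bar>s - of_rat q\<bar> < 2 * of_rat r \<longrightarrow> s \<in> U)"
proof -
  obtain \<epsilon> where \<epsilon>: "\<epsilon> > 0" "\<And>s. \<bar>s - t\<bar> < \<epsilon> \<Longrightarrow> s \<in> U"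
    using assms by (auto simp: open_dist dist_real_def)
  define \<delta> where "\<delta> = (if t = 0 then \<epsilon> else min \<epsilon> \<bar>t\<bar>)"
  have "\<delta> > 0" using \<epsilon> by (simp add: \<delta>_def)
  then obtain r where r: "0 < real_of_rat r" "real_of_rat r < \<delta> / 3"
    using of_rat_dense[of 0 "\<delta> / 3"] by auto
  have r0: "0 < r" using r(1) by simp
  show ?thesis
  proof (cases "t = 0")
    case True
    have "s \<in> U" if "\<bar>s\<bar> < 2 * real_of_rat r" for s
      using that r True \<epsilon>(2)[of s] by (simp add: \<delta>_def)
    then show ?thesis using r0 True by (intro exI[of _ 0] exI[of _ r]) auto
  next
    case False
    obtain q where q: "t - real_of_rat r < of_rat q" "of_rat q < t + real_of_rat r"
      using of_rat_dense[of "t - of_rat r" "t + of_rat r"] r(1) by auto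
    have "real_of_rat r < \<bar>t\<bar> / 3" using r(2) False by (simp add: \<delta>_def)
    with q have "2 * real_of_rat r \<le> \<bar>of_rat q\<bar>" by linarith
    then have "real_of_rat (2 * r) \<le> real_of_rat \<bar>q\<bar>" by (simp add: of_rat_mult)
    then have "2 * r \<le> \<bar>q\<bar>" unfolding of_rat_less_eq .
    moreover have "s \<in> U" if "\<bar>s - of_rat q\<bar> < 2 * real_of_rat r" for s
    proof -
      have "real_of_rat r < \<epsilon> / 3" using r(2) False by (simp add: \<delta>_def)
      with that q have "\<bar>s - t\<bar> < \<epsilon>" by linarith
      then show ?thesis by (rule \<epsilon>(2))
    qed
    moreover have "\<bar>t - of_rat q\<bar> \<le> real_of_rat r" using q by linarith
    ultimately show ?thesis using r0 by blast
  qed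
qed

lemma powertop_real_rational_base:
  fixes I :: "'i set"
  assumes W: "openin (powertop_real I) W" "f \<in> W"
  shows "\<exists>G :: ('i \<times> rat \<times> rat) set. finite G \<and>
    (\<forall>(i, q, r)\<in>G. i \<in> I \<and> 0 < r \<and> (q = 0 \<or> 2 * r \<le> \<bar>q\<bar>) \<and> \<bar>f i - of_rat q\<bar> \<le> of_rat r) \<and>
    (\<forall>g\<in>topspace (powertop_real I). (\<forall>(i, q, r)\<in>G. \<bar>g i - of_rat q\<bar> < 2 * of_rat r) \<longrightarrow> g \<in> W)"
proof -
  have "\<forall>g\<in>W. \<exists>U. finite {i \<in> I. U i \<noteq> topspace euclideanreal} \<and>
      (\<forall>i\<in>I. openin euclideanreal (U i)) \<and> g \<in> Pi\<^sub>E I U \<and> Pi\<^sub>E I U \<subseteq> W"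
    using W(1) unfolding openin_product_topology_alt .
  from bspec[OF this W(2)] obtain U where U: "finite {i \<in> I. U i \<noteq> UNIV}" "\<And>i. i \<in> I \<Longrightarrow> open (U i)"
    "f \<in> Pi\<^sub>E I U" "Pi\<^sub>E I U \<subseteq> W"
    by (auto simp only: topspace_euclidean open_openin)
  let ?F = "{i \<in> I. U i \<noteq> UNIV}"
  define R where "R i q r \<longleftrightarrow> 0 < r \<and> (q = 0 \<or> 2 * r \<le> \<bar>q\<bar>) \<and> \<bar>f i - of_rat q\<bar> \<le> of_rat r \<and>
           (\<forall>s. \<bar>s - of_rat q\<bar> < 2 * of_rat r \<longrightarrow> s \<in> U i)" for i and q r :: rat
  have "\<exists>q r. R i q r" if "i \<in> ?F" for i
    unfolding R_def using that U(2,3) by (intro rational_condition) auto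
  then obtain q r where "\<And>i. i \<in> ?F \<Longrightarrow> R i (q i) (r i)" by metis
  note qr = this[unfolded R_def]
  define G where "G = (\<lambda>i. (i, q i, r i)) ` ?F"
  have "g \<in> W" if g: "g \<in> topspace (powertop_real I)"
    "\<forall>i\<in>?F. \<bar>g i - of_rat (q i)\<bar> < 2 * of_rat (r i)" for g
  proof -
    have "g i \<in> U i" if "i \<in> I" for i
      using that g(2) qr[of i] by (cases "i \<in> ?F") simp_all
    then have "g \<in> Pi\<^sub>E I U" using g(1) by (simp add: PiE_iff)
    then show ?thesis using U(4) by blast
  qed
  then have "\<forall>g\<in>topspace (powertop_real I).
      (\<forall>(i, q, r)\<in>G. \<bar>g i - of_rat q\<bar> < 2 * of_rat r) \<longrightarrow> g \<in> W"
    by (simp add: G_def)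
  moreover have "\<forall>(i, q, r)\<in>G. i \<in> I \<and> 0 < r \<and> (q = 0 \<or> 2 * r \<le> \<bar>q\<bar>) \<and> \<bar>f i - of_rat q\<bar> \<le> of_rat r"
    using qr by (simp add: G_def)
  moreover have "finite G" using U(1) by (simp add: G_def)
  ultimately show ?thesis by (intro exI[of _ G] conjI)
qed

text \<open>Rational centres and radii leave countably many conditions per coordinate, so the countability of
  the set of non-zero coordinates of a point carries over to its support.\<close>

lemma condition_system_Corson:
  fixes X :: "'a topology" and I :: "'i set"
  assumes X: "compact_space X" and emb: "embedding_map X (sigma_product I) e"
  shows "condition_system X
    (\<lambda>(i, q, r). {x \<in> topspace X. \<bar>e x i - real_of_rat q\<bar> \<le> of_rat r})
    (\<lambda>(i, q, r). {x \<in> topspace X. \<bar>e x i - real_of_rat q\<bar> < 2 * of_rat r})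
    {(i, q, r). i \<in> I \<and> q = 0 \<and> 0 < r}
    {(i, q, r). i \<in> I \<and> 0 < r \<and> 2 * r \<le> \<bar>q\<bar>}"
    (is "condition_system X ?K ?Op ?J0 ?J1")
proof
  have homeo: "homeomorphic_map X (subtopology (sigma_product I) (e ` topspace X)) e"
    using emb by (simp add: embedding_map_def)
  have cont: "continuous_map X (sigma_product I) e"
    using homeomorphic_imp_continuous_map[OF homeo] by (simp add: continuous_map_in_subtopology)
  then have cont_power: "continuous_map X (powertop_real I) e"
    by (simp add: sigma_product_def continuous_map_in_subtopology)
  have coord: "continuous_map X euclideanreal (\<lambda>x. e x i)" if "i \<in> I" for i
    using cont_power that by (simp add: continuous_map_componentwise)
  have ctbl: "countable {i \<in> I. e x i \<noteq> 0}" if "x \<in> topspace X" for x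
    using cont that by (auto simp: sigma_product_def continuous_map_in_subtopology)
  have ctbl_conditions: "countable A"
    if "x \<in> topspace X" "fst ` A \<subseteq> {i \<in> I. e x i \<noteq> 0}" for x and A :: "('i \<times> rat \<times> rat) set"
  proof (rule countable_subset)
    show "A \<subseteq> {i \<in> I. e x i \<noteq> 0} \<times> UNIV" using that(2) by auto
  qed (use ctbl[OF that(1)] in auto)
  show "compact_space X" by (rule X)
  have "Hausdorff_space (sigma_product I)"
    by (simp add: sigma_product_def Hausdorff_space_subtopology Hausdorff_space_product_topology)
  then have "Hausdorff_space X"
    using homeo by (meson Hausdorff_space_subtopology homeomorphic_Hausdorff_space
        homeomorphic_map_imp_homeomorphic_space)
  then show "t1_space X" by (rule Hausdorff_imp_t1_space)
  show "closedin X (?K j)" "openin X (?Op j)" "?K j \<subseteq> ?Op j" if "j \<in> ?J0 \<union> ?J1" for j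
  proof -
    obtain i q r where jp: "j = (i, q, r)" by (cases j)
    with that have j: "j = (i, q, r)" "i \<in> I" "0 < r" by auto
    have dist: "continuous_map X euclideanreal (\<lambda>x. \<bar>e x i - real_of_rat q\<bar>)"
      using coord[OF j(2)] by (intro continuous_intros) auto
    show "closedin X (?K j)"
      using closedin_continuous_map_preimage[OF dist, of "{..real_of_rat r}"] j by simp
    show "openin X (?Op j)"
      using openin_continuous_map_preimage[OF dist, of "{..<2 * real_of_rat r}"] j by simp
    have "real_of_rat r > 0" using j by simp
    then have "s < 2 * real_of_rat r" if "s \<le> real_of_rat r" for s using that by linarith
    then show "?K j \<subseteq> ?Op j" using j by auto
  qed
  show "countable {j \<in> ?J0. x \<notin> ?K j}" if "x \<in> topspace X" for x
    using that by (intro ctbl_conditions[of x]) auto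
  show "countable {j \<in> ?J1. x \<in> ?Op j}" if x: "x \<in> topspace X" for x
  proof (rule ctbl_conditions[OF x])
    have "e x i \<noteq> 0" if "2 * r \<le> \<bar>q\<bar>" "\<bar>e x i - real_of_rat q\<bar> < 2 * of_rat r" for i q r
    proof -
      have "real_of_rat (2 * r) \<le> of_rat \<bar>q\<bar>" using that(1) unfolding of_rat_less_eq .
      then show ?thesis using that(2) by (auto simp: of_rat_mult)
    qed
    then show "fst ` {j \<in> ?J1. x \<in> ?Op j} \<subseteq> {i \<in> I. e x i \<noteq> 0}" by auto
  qed
  show "\<exists>G. finite G \<and> G \<subseteq> ?J0 \<union> ?J1 \<and> (\<forall>j\<in>G. y \<in> ?K j) \<and>
      {x \<in> topspace X. \<forall>j\<in>G. x \<in> ?Op j} \<subseteq> V" if V: "openin X V" "y \<in> V" for V y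
  proof -
    have V_sub: "V \<subseteq> topspace X" using V(1) by (rule openin_subset)
    have "openin (subtopology (sigma_product I) (e ` topspace X)) (e ` V)"
      using homeomorphic_map_openness[OF homeo V_sub] V(1) by blast
    then obtain W where W: "openin (powertop_real I) W"
      "e ` V = W \<inter> {f. countable {i \<in> I. f i \<noteq> 0}} \<inter> e ` topspace X"
      unfolding sigma_product_def openin_subtopology by blast
    then have "e y \<in> W" using V(2) by blast
    from powertop_real_rational_base[OF W(1) this] obtain G :: "('i \<times> rat \<times> rat) set" where
      G: "finite G" "\<forall>(i, q, r)\<in>G. i \<in> I \<and> 0 < r \<and> (q = 0 \<or> 2 * r \<le> \<bar>q\<bar>) \<and>
          \<bar>e y i - of_rat q\<bar> \<le> of_rat r"
        "\<forall>g\<in>topspace (powertop_real I).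
          (\<forall>(i, q, r)\<in>G. \<bar>g i - of_rat q\<bar> < 2 * of_rat r) \<longrightarrow> g \<in> W"
      by (elim exE conjE)
    have "x \<in> V" if "x \<in> topspace X" "\<forall>j\<in>G. x \<in> ?Op j" for x
    proof -
      have "e x \<in> topspace (powertop_real I)"
        using cont_power that(1) by (auto simp: continuous_map_def)
      moreover have "\<forall>(i, q, r)\<in>G. \<bar>e x i - of_rat q\<bar> < 2 * of_rat r"
        using that(2) by (simp add: split_beta)
      ultimately have "e x \<in> W" using G(3) by blast
      then have "e x \<in> e ` V" using W(2) ctbl that(1) by auto
      then show ?thesis
        using homeo that(1) V_sub by (auto simp: homeomorphic_eq_everything_map inj_on_def)
    qed
    then have "{x \<in> topspace X. \<forall>j\<in>G. x \<in> ?Op j} \<subseteq> V" by (intro subsetI) simp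
    moreover have "G \<subseteq> ?J0 \<union> ?J1" using G(2) by auto
    moreover have "\<forall>j\<in>G. y \<in> ?K j" using G(2) V(2) V_sub by auto
    ultimately show ?thesis using G(1) by (intro exI[of _ G] conjI)
  qed
qed

theorem theorem3p4:
  fixes X :: "'a topology"
  assumes "Corson_compact TYPE('i) X"
  shows "hereditarily_D_space X"
proof -
  obtain I :: "'i set" and e where "compact_space X" "embedding_map X (sigma_product I) e"
    using assms unfolding Corson_compact_def by blast
  then interpret condition_system X
    "\<lambda>(i, q, r). {x \<in> topspace X. \<bar>e x i - real_of_rat q\<bar> \<le> of_rat r}"
    "\<lambda>(i, q, r). {x \<in> topspace X. \<bar>e x i - real_of_rat q\<bar> < 2 * of_rat r}"
    "{(i, q, r). i \<in> I \<and> q = 0 \<and> 0 < r}"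
    "{(i, q, r). i \<in> I \<and> 0 < r \<and> 2 * r \<le> \<bar>q\<bar>}"
    by (rule condition_system_Corson)
  show ?thesis by (rule hereditarily_D)
qed

end
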